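(* In the setting described in the context, let $y\in\mathcal R(A)$ and $u^\dagger:=A^{-1}y$. Assume that: (a) $\displaystyle\sum_{i=1}^\infty|(u^\dagger,\overline u^i)|<\infty$; (b) there is a constant $C>0$ such that for every $n\in\mathbb N$ and every $i\geq n+1$ the coefficients $\beta_j^{i,n}$ of the expansion $P_{\mathcal Y_n}\overline y^i=\sum_{j=1}^n\beta_j^{i,n}\,\overline y^j$ satisfy $\sum_{j=1}^n(\beta_j^{i,n})^2\leq C$ (with $C$ independent of $i$ and $n$). Then $u_n^{\mathcal U}:=A^{-1}P_{\mathcal Y_n}y$ is uniformly bounded with respect to $n$, i.e. $\sup_{n\in\mathbb N}\|u_n^{\mathcal U}\|<\infty$.
   Context: $\mathcal U$ and $\mathcal Y$ are separable real Hilbert spaces and $A\colon\mathcal U\to\mathcal Y$ is a bounded linear injective operator whose inverse $A^{-1}\colon\mathcal R(A)\to\mathcal U$ is unbounded. The training pairs $\{u^i,y^i\}_{i\in\mathbb N}\subset\mathcal U\times\mathcal Y$ satisfy $Au^i=y^i$ for all $i$; for every $n$ the inputs $u^1,\dots,u^n$ are linearly independent; $\|u^i\|=1$ for all $i$; and $\overline{\bigcup_{n}\mathcal U_n}=\mathcal U$ (closure), where $\mathcal U_n:=\mathrm{Span}\{u^1,\dots,u^n\}$. Further $\mathcal Y_n:=\mathrm{Span}\{y^1,\dots,y^n\}\subset\mathcal R(A)$, and $P_{\mathcal Y_n}$ denotes the orthogonal projection onto $\mathcal Y_n$. The sequence $\{\overline u^i\}_{i\in\mathbb N}$ is the orthonormal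 basis of $\mathcal U$ obtained by applying the Gram-Schmidt process to $\{u^i\}_{i\in\mathbb N}$, and $\overline y^i:=A\overline u^i$, so that $\{\overline y^i\}_{i=1,\dots,n}$ is a (generally non-orthogonal) basis of $\mathcal Y_n$ for every $n$. *)

theory Defs
  imports "HOL-Analysis.Analysis"
begin

text \<open>Sequences are indexed from 0: \<open>u 0\<close>, \<open>u 1\<close>, ... stand for \<open>u\<^sup>1\<close>, \<open>u\<^sup>2\<close>, ..., so that the
  first \<open>n\<close> vectors are \<open>u ` {..<n}\<close> and an index \<open>i \<ge> n + 1\<close> becomes \<open>n \<le> i\<close>.\<close>

text \<open>The library's \<open>closest_point\<close> requires a locally compact space, so it is not available
  here. The value is specified only if the projection of \<open>x\<close> onto \<open>S\<close> exists.\<close>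

definition orth_proj :: "'a::real_inner set \<Rightarrow> 'a \<Rightarrow> 'a" where
  "orth_proj S x = (THE p. p \<in> S \<and> (\<forall>s\<in>S. orthogonal (x - p) s))"

lemma orth_proj_eqI:
  assumes "subspace S" "p \<in> S" "\<And>s. s \<in> S \<Longrightarrow> orthogonal (x - p) s"
  shows "orth_proj S x = p"
  unfolding orth_proj_def
proof (rule the_equality)
  show "p \<in> S \<and> (\<forall>s\<in>S. orthogonal (x - p) s)"
    using assms by blast
next
  fix q assume q: "q \<in> S \<and> (\<forall>s\<in>S. orthogonal (x - q) s)"
  have "p - q \<in> S"
    using assms q by (simp add: subspace_diff)
  then have "(x - q) \<bullet> (p - q) = 0" "(x - p) \<bullet> (p - q) = 0"
    using assms q by (auto simp: orthogonal_def)
  then have "(p - q) \<bullet> (p - q) = 0"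
    by (simp add: inner_diff_left)
  then show "q = p" by simp
qed

lemma finite_span_orth_decomp:
  fixes B :: "'a::real_inner set"
  assumes "finite B"
  shows "\<exists>p\<in>span B. \<forall>s\<in>span B. orthogonal (x - p) s"
  using assms
proof (induction B arbitrary: x rule: finite_induct)
  case empty
  show ?case by (simp add: orthogonal_def)
next
  case (insert a B)
  obtain p where p: "p \<in> span B" "\<And>s. s \<in> span B \<Longrightarrow> (x - p) \<bullet> s = 0"
    using insert.IH[of x] by (auto simp: orthogonal_def)
  obtain q where q: "q \<in> span B" "\<And>s. s \<in> span B \<Longrightarrow> (a - q) \<bullet> s = 0"
    using insert.IH[of a] by (auto simp: orthogonal_def)
  define r where "r = a - q"
  define c where "c = (x \<bullet> r) / (r \<bullet> r)"
  have sub: "span B \<subseteq> span (insert a B)"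
    by (rule span_mono) blast
  have r: "r \<in> span (insert a B)"
    unfolding r_def using q(1) sub by (intro span_diff) (auto intro: span_base)
  have cr: "c * (r \<bullet> r) = x \<bullet> r"
    by (simp add: c_def)
  have pr: "r \<bullet> p = 0" "p \<bullet> r = 0"
    using q(2)[OF p(1)] by (simp_all add: r_def inner_commute)
  show ?case
  proof (rule bexI[of _ "p + c *\<^sub>R r"], rule ballI)
    show "p + c *\<^sub>R r \<in> span (insert a B)"
      using p(1) r sub by (intro span_add span_scale) auto
  next
    fix s assume "s \<in> span (insert a B)"
    then obtain k where k: "s - k *\<^sub>R a \<in> span B"
      by (auto simp: span_insert)
    define t where "t = s - k *\<^sub>R a + k *\<^sub>R q"
    have t: "t \<in> span B"
      unfolding t_def using k q(1) by (intro span_add span_scale)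
    have s: "s = t + k *\<^sub>R r"
      by (simp add: t_def r_def algebra_simps)
    have "(x - p) \<bullet> t = 0" "r \<bullet> t = 0"
      using p(2) q(2) t by (auto simp: r_def)
    then have "(x - (p + c *\<^sub>R r)) \<bullet> s = 0"
      using cr pr unfolding s
      by (simp add: inner_diff_left inner_add_left inner_add_right algebra_simps)
    then show "orthogonal (x - (p + c *\<^sub>R r)) s"
      by (simp add: orthogonal_def)
  qed
qed

lemma orth_proj_span_finite:
  fixes B :: "'a::real_inner set"
  assumes "finite B"
  shows "orth_proj (span B) x \<in> span B"
    and "\<And>s. s \<in> span B \<Longrightarrow> orthogonal (x - orth_proj (span B) x) s"
  using finite_span_orth_decomp[OF assms, of x] orth_proj_eqI[OF subspace_span]
  by metis+

text \<open>\<open>sgn v = v /\<^sub>R norm v\<close> is the normalisation of \<open>v\<close>.\<close>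

fun gram_schmidt :: "(nat \<Rightarrow> 'a::real_inner) \<Rightarrow> nat \<Rightarrow> 'a" where
  "gram_schmidt u n = sgn (u n - (\<Sum>k<n. (u n \<bullet> gram_schmidt u k) *\<^sub>R gram_schmidt u k))"

text \<open>The recursion is unconditional, so it would make the simplifier loop.\<close>

declare gram_schmidt.simps [simp del]

end

theory Submission
  imports Defs
begin

text \<open>
  Let \<open>e i\<close> be the Gram-Schmidt basis of \<open>u\<close>, let \<open>c i\<close> be the coefficients of \<open>u_dag\<close> in it, and
  let \<open>P\<close> be the orthogonal projection onto \<open>Y_sp n\<close>. Formally, applying \<open>A\<inverse> P A\<close> termwise to
  \<open>u_dag = (\<Sum>i. c i *\<^sub>R e i)\<close> gives
  \<open>A\<inverse> P y = (\<Sum>i. c i *\<^sub>R w i)\<close> with \<open>w i = A\<inverse> P A (e i)\<close>. All \<open>w i\<close> are bounded by a single constant: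
  for \<open>i < n\<close> the vector \<open>A (e i)\<close> lies in \<open>Y_sp n\<close>, so \<open>w i = e i\<close> has norm 1; for \<open>n \<le> i\<close> the
  expansion of \<open>P A (e i)\<close> shows \<open>w i = (\<Sum>j<n. \<beta> i n j *\<^sub>R e j)\<close>, and since the \<open>e j\<close> are
  orthonormal its squared norm is \<open>\<Sum>j<n. (\<beta> i n j)\<^sup>2 \<le> C\<close>. Hence
  \<open>norm (A\<inverse> P y) \<le> max 1 (sqrt C) * (\<Sum>i. \<bar>c i\<bar>)\<close>, independently of \<open>n\<close>.

  The termwise application has to be justified without continuity of \<open>A\<inverse>\<close>. The series
  \<open>\<Sum>i. c i *\<^sub>R w i\<close> converges absolutely, hence to some \<open>s\<close> (lemma
  \<open>sums_of_norm_le_summable\<close>), and the continuous maps \<open>A\<close> and \<open>P\<close> may be applied termwise: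
  \<open>A s = (\<Sum>i. c i *\<^sub>R P (A (e i))) = P (A u_dag) = P y\<close>, so \<open>s = A\<inverse> P y\<close> by injectivity. The
  expansion \<open>u_dag = (\<Sum>i. c i *\<^sub>R e i)\<close> comes from the same convergence lemma and the
  density of the span of the inputs (lemma \<open>orthonormal_expansion_sums\<close>).
\<close>

text \<open>Bounding the sum in the same step is what later gives the estimate that is uniform in \<open>n\<close>.
  The partial sums are compared directly, since the sort \<open>{real_normed_vector, complete_space}\<close>
  does not entail the class \<open>banach\<close>.\<close>

lemma sums_of_norm_le_summable:
  fixes f :: "nat \<Rightarrow> 'a::{real_normed_vector, complete_space}"
  assumes le: "\<And>i. norm (f i) \<le> g i" and g: "summable g"
  obtains s where "f sums s" "norm s \<le> suminf g"
proof -
  have block: "norm (sum f {m..<n}) \<le> sum g {m..<n}" for m n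
    by (rule sum_norm_le) (rule le)
  have "Cauchy (\<lambda>n. sum f {..<n})"
  proof (rule CauchyI')
    fix \<epsilon> :: real assume "\<epsilon> > 0"
    then obtain N where N: "\<And>m n. N \<le> m \<Longrightarrow> norm (sum g {m..<n}) < \<epsilon>"
      using g unfolding summable_Cauchy by blast
    have "norm (sum f {..<m} - sum f {..<n}) < \<epsilon>" if "N \<le> m" "m < n" for m n
    proof -
      have "sum f {..<n} - sum f {..<m} = sum f {m..<n}"
        using that sum_diff_nat_ivl[of 0 m n f] by (simp add: atLeast0LessThan)
      then have "norm (sum f {..<m} - sum f {..<n}) = norm (sum f {m..<n})"
        by (metis norm_minus_commute)
      then show ?thesis
        using block[of m n] N[OF that(1), of n] by simp
    qed
    then show "\<exists>M. \<forall>m\<ge>M. \<forall>n>m. dist (sum f {..<m}) (sum f {..<n}) < \<epsilon>"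
      unfolding dist_norm by blast
  qed
  then obtain s where s: "f sums s"
    unfolding sums_def using Cauchy_convergent convergent_def by blast
  have "norm (sum f {..<n}) \<le> suminf g" for n
  proof -
    have "norm (sum f {..<n}) \<le> sum g {..<n}"
      using block[of 0 n] by (simp add: atLeast0LessThan)
    also have "\<dots> \<le> suminf g"
      using g le by (intro sum_le_suminf) (auto intro: order_trans[OF norm_ge_zero])
    finally show ?thesis .
  qed
  then have "norm s \<le> suminf g"
    using s[unfolded sums_def] by (intro Lim_norm_ubound[OF trivial_limit_sequentially]) auto
  with s show thesis by (rule that)
qed

section \<open>Orthonormal systems\<close>

text \<open>Absolute summability of the coefficients makes the Fourier series converge, and by density
  the difference between \<open>x\<close> and the sum, being orthogonal to every \<open>e i\<close>, is 0.\<close>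

lemma orthonormal_expansion_sums:
  fixes e :: "nat \<Rightarrow> 'a::{real_inner, complete_space}"
  assumes orthonormal: "\<And>i j. e i \<bullet> e j = (if i = j then 1 else 0)"
    and total: "closure (span (range e)) = UNIV"
    and summable: "summable (\<lambda>i. \<bar>x \<bullet> e i\<bar>)"
  shows "(\<lambda>i. (x \<bullet> e i) *\<^sub>R e i) sums x"
proof -
  have "norm (e i) = 1" for i
    using orthonormal[of i i] by (simp add: norm_eq_1)
  then obtain s where s: "(\<lambda>i. (x \<bullet> e i) *\<^sub>R e i) sums s"
    using sums_of_norm_le_summable[OF _ summable, of "\<lambda>i. (x \<bullet> e i) *\<^sub>R e i"] by auto
  have "(x - s) \<bullet> e j = 0" for j
  proof -
    have "(\<lambda>i. ((x \<bullet> e i) *\<^sub>R e i) \<bullet> e j) sums (s \<bullet> e j)"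
      by (rule bounded_linear.sums[OF bounded_linear_inner_left s])
    moreover have "(\<lambda>i. ((x \<bullet> e i) *\<^sub>R e i) \<bullet> e j) = (\<lambda>i. if i = j then x \<bullet> e i else 0)"
      by (auto simp: orthonormal)
    ultimately have "s \<bullet> e j = x \<bullet> e j"
      using sums_single[of j "\<lambda>i. x \<bullet> e i"] sums_unique2 by metis
    then show ?thesis by (simp add: inner_diff_left)
  qed
  then have "span (range e) \<subseteq> {v. (x - s) \<bullet> v = 0}"
    by (intro span_minimal subspace_hyperplane) auto
  then have "closure (span (range e)) \<subseteq> {v. (x - s) \<bullet> v = 0}"
    by (intro closure_minimal closed_hyperplane)
  then have "(x - s) \<bullet> (x - s) = 0"
    using total by blast
  with s show ?thesis by simp
qed

lemma norm_orthonormal_combination_squared: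
  fixes e :: "nat \<Rightarrow> 'a::real_inner"
  assumes "\<And>i j. e i \<bullet> e j = (if i = j then 1 else 0)" and "finite I"
  shows "(norm (\<Sum>j\<in>I. b j *\<^sub>R e j))\<^sup>2 = (\<Sum>j\<in>I. (b j)\<^sup>2)"
proof -
  have "(norm (\<Sum>j\<in>I. b j *\<^sub>R e j))\<^sup>2 = (\<Sum>j\<in>I. \<Sum>k\<in>I. if j = k then b j * b j else 0)"
    unfolding power2_norm_eq_inner inner_sum_left inner_sum_right
    by (intro sum.cong) (auto simp: assms(1))
  also have "\<dots> = (\<Sum>j\<in>I. (b j)\<^sup>2)"
    using assms(2) by (simp add: power2_eq_square)
  finally show ?thesis .
qed

section \<open>The Gram-Schmidt process\<close>

text \<open>An input that depends linearly on its predecessors produces the vector 0, which disturbs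
  neither orthogonality nor the spans but is not a unit vector. So independence enters at
  normalisation, where it keeps the residuals nonzero.\<close>

lemma gram_schmidt_orthogonal_less:
  "j < n \<Longrightarrow> gram_schmidt u n \<bullet> gram_schmidt u j = 0"
proof (induction n arbitrary: j rule: less_induct)
  case (less n)
  let ?e = "gram_schmidt u"
  have offdiag: "?e k \<bullet> ?e j = 0" if "k < n" "k \<noteq> j" for k
    using that less.IH[of k j] less.IH[of j k] less.prems
    by (cases "k < j") (auto simp: inner_commute)
  \<comment> \<open>Each \<open>?e j\<close> is 0 or a unit vector, so subtracting the \<open>j\<close>-th term removes the component
    along it in both cases.\<close>
  have unit: "?e j \<bullet> ?e j = 1 \<or> ?e j = 0"
    using norm_sgn[of "u j - (\<Sum>k<j. (u j \<bullet> ?e k) *\<^sub>R ?e k)"]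
    by (metis gram_schmidt.simps norm_eq_1 sgn_zero)
  have "(\<Sum>k<n. (u n \<bullet> ?e k) *\<^sub>R ?e k) \<bullet> ?e j
      = (\<Sum>k<n. if k = j then (u n \<bullet> ?e j) * (?e j \<bullet> ?e j) else 0)"
    unfolding inner_sum_left by (rule sum.cong) (auto simp: offdiag)
  also have "\<dots> = u n \<bullet> ?e j"
    using less.prems unit by auto
  finally have "(u n - (\<Sum>k<n. (u n \<bullet> ?e k) *\<^sub>R ?e k)) \<bullet> ?e j = 0"
    by (simp add: inner_diff_left)
  then show ?case
    by (subst gram_schmidt.simps) (simp add: sgn_div_norm)
qed

lemma gram_schmidt_orthogonal:
  "i \<noteq> j \<Longrightarrow> gram_schmidt u i \<bullet> gram_schmidt u j = 0"
  by (metis gram_schmidt_orthogonal_less inner_commute linorder_neqE_nat)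

lemma span_gram_schmidt:
  "span (gram_schmidt u ` {..<n}) = span (u ` {..<n})"
proof (induction n)
  case 0
  show ?case by simp
next
  case (Suc n)
  let ?e = "gram_schmidt u"
  define p where "p = (\<Sum>k<n. (u n \<bullet> ?e k) *\<^sub>R ?e k)"
  have e: "?e n = inverse (norm (u n - p)) *\<^sub>R (u n - p)"
    unfolding p_def by (subst gram_schmidt.simps) (simp add: sgn_div_norm)
  have u: "u n = p + norm (u n - p) *\<^sub>R ?e n"
    unfolding e by (cases "u n = p") auto
  have p_e: "p \<in> span (?e ` {..<n})"
    unfolding p_def by (intro span_sum span_scale span_base) auto
  then have p_u: "p \<in> span (u ` {..<n})"
    by (simp add: Suc)
  have mono: "span (f ` {..<n}) \<subseteq> span (f ` {..<Suc n})" for f :: "nat \<Rightarrow> 'a"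
    by (intro span_mono) auto
  have last: "f n \<in> span (f ` {..<Suc n})" for f :: "nat \<Rightarrow> 'a"
    by (intro span_base) auto
  have "?e n \<in> span (u ` {..<Suc n})"
    by (subst e) (intro span_scale span_diff last subsetD[OF mono p_u])
  then have "?e ` {..<Suc n} \<subseteq> span (u ` {..<Suc n})"
    using mono[of u] span_superset[of "?e ` {..<n}"] by (auto simp: lessThan_Suc Suc)
  moreover have "u n \<in> span (?e ` {..<Suc n})"
    by (subst u) (intro span_add span_scale last subsetD[OF mono p_e])
  then have "u ` {..<Suc n} \<subseteq> span (?e ` {..<Suc n})"
    using mono[of ?e] span_superset[of "u ` {..<n}"] by (auto simp: lessThan_Suc Suc)
  ultimately show ?case
    by (intro subset_antisym span_minimal subspace_span)
qed

lemma norm_gram_schmidt: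
  assumes "u n \<notin> span (u ` {..<n})"
  shows "norm (gram_schmidt u n) = 1"
proof -
  have "(\<Sum>k<n. (u n \<bullet> gram_schmidt u k) *\<^sub>R gram_schmidt u k) \<in> span (gram_schmidt u ` {..<n})"
    by (intro span_sum span_scale span_base) auto
  then have "u n \<noteq> (\<Sum>k<n. (u n \<bullet> gram_schmidt u k) *\<^sub>R gram_schmidt u k)"
    using assms span_gram_schmidt by metis
  then show ?thesis
    by (subst gram_schmidt.simps) (simp add: norm_sgn)
qed

lemma gram_schmidt_orthonormal:
  assumes "\<And>n. inj_on u {..<n} \<and> independent (u ` {..<n})"
  shows "gram_schmidt u i \<bullet> gram_schmidt u j = (if i = j then 1 else 0)"
proof -
  have "u i \<notin> span (u ` {..<i})"
  proof -
    have "u i \<notin> u ` {..<i}"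
      using assms[of "Suc i"] by (force simp: inj_on_def)
    then show ?thesis
      using assms[of "Suc i"] by (simp add: lessThan_Suc independent_insert)
  qed
  then have "gram_schmidt u i \<bullet> gram_schmidt u i = 1"
    using norm_gram_schmidt norm_eq_1 by blast
  then show ?thesis
    using gram_schmidt_orthogonal[of i j u] by auto
qed

section \<open>Projections onto finitely spanned subspaces\<close>

lemma bounded_linear_orth_proj:
  fixes B :: "'a::real_inner set"
  assumes "finite B"
  shows "bounded_linear (orth_proj (span B))"
proof (rule bounded_linear_intro)
  let ?P = "orth_proj (span B)"
  have mem: "?P x \<in> span B" and orth: "s \<in> span B \<Longrightarrow> (x - ?P x) \<bullet> s = 0" for x s
    using orth_proj_span_finite[OF assms] by (simp_all add: orthogonal_def)
  show "?P (x + z) = ?P x + ?P z" for x z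
    using orth[of _ x] orth[of _ z]
    by (intro orth_proj_eqI subspace_span span_add mem)
      (simp add: orthogonal_def inner_diff_left inner_add_left)
  show "?P (r *\<^sub>R x) = r *\<^sub>R ?P x" for r x
    using orth[of _ x]
    by (intro orth_proj_eqI subspace_span span_scale mem)
      (simp add: orthogonal_def inner_diff_left)
  show "norm (?P x) \<le> norm x * 1" for x
  proof -
    have "?P x \<bullet> ?P x = x \<bullet> ?P x"
      using orth[OF mem, of x] by (simp add: inner_diff_left)
    also have "\<dots> \<le> norm x * norm (?P x)"
      by (rule norm_cauchy_schwarz)
    finally have "norm (?P x) * norm (?P x) \<le> norm x * norm (?P x)"
      by (simp add: power2_norm_eq_inner[symmetric] power2_eq_square)
    then show ?thesis
      by (cases "?P x = 0") auto
  qed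
qed

section \<open>Uniform boundedness\<close>

theorem theorem11:
  fixes A :: "'u::{real_inner, complete_space} \<Rightarrow> 'y::{real_inner, complete_space}"
    and u :: "nat \<Rightarrow> 'u" and y_data :: "nat \<Rightarrow> 'y"
    and ubar :: "nat \<Rightarrow> 'u" and ybar :: "nat \<Rightarrow> 'y"
    and U_sp :: "nat \<Rightarrow> 'u set" and Y_sp :: "nat \<Rightarrow> 'y set"
    and y :: 'y and u_dag :: 'u
    and \<beta> :: "nat \<Rightarrow> nat \<Rightarrow> nat \<Rightarrow> real" and C :: real
  defines "ubar \<equiv> gram_schmidt u"
    and "ybar \<equiv> \<lambda>i. A (ubar i)"
    and "U_sp \<equiv> \<lambda>n. span (u ` {..<n})"
    and "Y_sp \<equiv> \<lambda>n. span (y_data ` {..<n})"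
    and "u_dag \<equiv> inv A y"
  assumes separable_U: "separable_space (euclidean :: 'u topology)"
    and separable_Y: "separable_space (euclidean :: 'y topology)"
    and A_bounded: "bounded_linear A"
    and A_inj: "inj A"
    and A_inv_unbounded: "\<not> (\<exists>K. \<forall>z\<in>range A. norm (inv A z) \<le> K * norm z)"
    and data: "\<And>i. A (u i) = y_data i"
    and lin_indep: "\<And>n. inj_on u {..<n} \<and> independent (u ` {..<n})"
    and normalized: "\<And>i. norm (u i) = 1"
    and dense: "closure (\<Union>n. U_sp n) = UNIV"
    and y_range: "y \<in> range A"
    and summable_coeffs: "summable (\<lambda>i. \<bar>u_dag \<bullet> ubar i\<bar>)"
    and C_pos: "C > 0"
    and expansion: "\<And>n i. n \<le> i \<Longrightarrow> orth_proj (Y_sp n) (ybar i) = (\<Sum>j<n. \<beta> i n j *\<^sub>R ybar j)"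
    and coeff_bound: "\<And>n i. n \<le> i \<Longrightarrow> (\<Sum>j<n. (\<beta> i n j)\<^sup>2) \<le> C"
  shows "bdd_above (range (\<lambda>n. norm (inv A (orth_proj (Y_sp n) y))))"
proof -
  note orthonormal = gram_schmidt_orthonormal[OF lin_indep, folded ubar_def]
  interpret A: bounded_linear A by (rule A_bounded)
  define c where "c i = u_dag \<bullet> ubar i" for i
  define K where "K = max 1 (sqrt C)"
  have A_u_dag: "A u_dag = y"
    using y_range by (simp add: u_dag_def f_inv_into_f)
  have Y_sp_ubar: "Y_sp n = span (ybar ` {..<n})" for n
  proof -
    have "Y_sp n = A ` U_sp n"
      using linear_span_image[OF A.linear_axioms, of "u ` {..<n}"]
      by (simp add: Y_sp_def U_sp_def image_image data)
    also have "\<dots> = A ` span (ubar ` {..<n})"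
      by (simp add: U_sp_def ubar_def span_gram_schmidt)
    also have "\<dots> = span (ybar ` {..<n})"
      using linear_span_image[OF A.linear_axioms, of "ubar ` {..<n}"]
      by (simp add: ybar_def image_image)
    finally show ?thesis .
  qed
  have "(\<Union>n. U_sp n) \<subseteq> span (range ubar)"
    unfolding U_sp_def ubar_def span_gram_schmidt[of u, symmetric] by (intro UN_least span_mono) auto
  then have "closure (span (range ubar)) = UNIV"
    using dense closure_mono by blast
  then have u_dag_sums: "(\<lambda>i. c i *\<^sub>R ubar i) sums u_dag"
    unfolding c_def using orthonormal summable_coeffs
    by (intro orthonormal_expansion_sums) auto
  have bound: "norm (inv A (orth_proj (Y_sp n) y)) \<le> (\<Sum>i. \<bar>c i\<bar> * K)" for n
  proof -
    let ?P = "orth_proj (Y_sp n)"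
    interpret P: bounded_linear ?P
      unfolding Y_sp_def by (rule bounded_linear_orth_proj) simp
    define w where "w i = (if i < n then ubar i else \<Sum>j<n. \<beta> i n j *\<^sub>R ubar j)" for i
    have A_w: "A (w i) = ?P (A (ubar i))" for i
    proof (cases "i < n")
      case True
      then have "ybar i \<in> Y_sp n"
        unfolding Y_sp_ubar by (intro span_base) auto
      then have "?P (ybar i) = ybar i"
        unfolding Y_sp_def by (intro orth_proj_eqI) (auto simp: orthogonal_def)
      with True show ?thesis
        by (simp add: w_def ybar_def)
    next
      case False
      then show ?thesis
        using expansion[of n i] by (simp add: w_def ybar_def A.sum A.scaleR)
    qed
    have norm_w: "norm (w i) \<le> K" for i
    proof (cases "i < n")
      case True
      then have "norm (w i) = 1"
        using orthonormal[of i i] by (simp add: w_def norm_eq_1)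
      then show ?thesis
        by (simp add: K_def)
    next
      case False
      then have "(norm (w i))\<^sup>2 \<le> C"
        using coeff_bound[of n i] norm_orthonormal_combination_squared[OF orthonormal]
        by (simp add: w_def)
      then show ?thesis
        by (simp add: K_def real_le_rsqrt le_max_iff_disj)
    qed
    have "norm (c i *\<^sub>R w i) \<le> \<bar>c i\<bar> * K" for i
      using norm_w by (simp add: mult_left_mono)
    moreover have "summable (\<lambda>i. \<bar>c i\<bar> * K)"
      using summable_coeffs unfolding c_def by (rule summable_mult2)
    ultimately obtain s where s: "(\<lambda>i. c i *\<^sub>R w i) sums s" "norm s \<le> (\<Sum>i. \<bar>c i\<bar> * K)"
      by (rule sums_of_norm_le_summable)
    have "(\<lambda>i. A (c i *\<^sub>R w i)) sums ?P (A u_dag)"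
      using P.sums[OF A.sums[OF u_dag_sums]] by (simp add: A.scaleR P.scaleR A_w)
    then have "A s = ?P y"
      using sums_unique2[OF A.sums[OF s(1)]] by (simp add: A_u_dag)
    then have "inv A (?P y) = s"
      using A_inj by (metis inv_f_f)
    with s(2) show ?thesis by simp
  qed
  then show ?thesis
    by (intro bdd_aboveI2)
qed

end
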